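(* Let $h:J\subseteq\mathbb{R}\to\mathbb{R}$ be a non-negative function, $m\in[0,1]$ and $b>0$. If $f,g:[0,b]\to\mathbb{R}$ are $(h-m)$-convex functions and $\lambda>0$, then $f+g$ and $\lambda f$ are $(h-m)$-convex functions.
   Context: Let $h:J\subseteq\mathbb{R}\to\mathbb{R}$ be a non-negative function, where $J$ is an interval containing $(0,1)$, and let $m\in[0,1]$. A function $f:[0,b]\to\mathbb{R}$ is called $(h-m)$-convex if $f$ is non-negative and for all $x,y\in[0,b]$ and all $\alpha\in(0,1)$, $$f(\alpha x+m(1-\alpha)y)\le h(\alpha)f(x)+m\,h(1-\alpha)f(y).$$ *)

theory Defs
  imports "HOL-Analysis.Analysis"
begin

(* A function on [0,b] is a total function of which only the values on {0..b} are used.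
   Likewise only the values of h on the open interval (0,1) occur. *)
definition hm_convex :: "(real \<Rightarrow> real) \<Rightarrow> real \<Rightarrow> real \<Rightarrow> (real \<Rightarrow> real) \<Rightarrow> bool"
  where "hm_convex h m b f \<longleftrightarrow>
    (\<forall>x\<in>{0..b}. 0 \<le> f x) \<and>
    (\<forall>x\<in>{0..b}. \<forall>y\<in>{0..b}. \<forall>\<alpha>\<in>{0<..<1}.
      f (\<alpha> * x + m * (1 - \<alpha>) * y) \<le> h \<alpha> * f x + m * h (1 - \<alpha>) * f y)"

end

theory Submission
  imports Defs
begin

text \<open>
  For fixed points and a fixed weight, the defining inequality of $(h-m)$-convexity has both
  sides linear in the values of the function. Hence inequalities for two functions may be added,
  and one inequality may be multiplied by a nonnegative constant.
\<close>

lemma hm_convex_add: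
  assumes f: "hm_convex h m b f" and g: "hm_convex h m b g"
  shows "hm_convex h m b (\<lambda>x. f x + g x)"
  unfolding hm_convex_def
proof (intro conjI ballI)
  fix x assume "x \<in> {0..b}"
  then show "0 \<le> f x + g x"
    using f g by (simp add: hm_convex_def)
next
  fix x y \<alpha> :: real
  assume xy: "x \<in> {0..b}" "y \<in> {0..b}" and \<alpha>: "\<alpha> \<in> {0<..<1}"
  let ?z = "\<alpha> * x + m * (1 - \<alpha>) * y"
  have "f ?z \<le> h \<alpha> * f x + m * h (1 - \<alpha>) * f y"
    using f xy \<alpha> unfolding hm_convex_def by blast
  moreover have "g ?z \<le> h \<alpha> * g x + m * h (1 - \<alpha>) * g y"
    using g xy \<alpha> unfolding hm_convex_def by blast
  ultimately show "f ?z + g ?z \<le> h \<alpha> * (f x + g x) + m * h (1 - \<alpha>) * (f y + g y)"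
    by (simp add: distrib_left)
qed

lemma hm_convex_cmult:
  assumes f: "hm_convex h m b f" and c: "0 \<le> c"
  shows "hm_convex h m b (\<lambda>x. c * f x)"
  unfolding hm_convex_def
proof (intro conjI ballI)
  fix x assume "x \<in> {0..b}"
  then show "0 \<le> c * f x"
    using f c by (simp add: hm_convex_def)
next
  fix x y \<alpha> :: real
  assume xy: "x \<in> {0..b}" "y \<in> {0..b}" and \<alpha>: "\<alpha> \<in> {0<..<1}"
  let ?z = "\<alpha> * x + m * (1 - \<alpha>) * y"
  have "f ?z \<le> h \<alpha> * f x + m * h (1 - \<alpha>) * f y"
    using f xy \<alpha> unfolding hm_convex_def by blast
  then have "c * f ?z \<le> c * (h \<alpha> * f x + m * h (1 - \<alpha>) * f y)"
    using c by (rule mult_left_mono)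
  then show "c * f ?z \<le> h \<alpha> * (c * f x) + m * h (1 - \<alpha>) * (c * f y)"
    by (simp add: algebra_simps)
qed

theorem proposition2:
  fixes J :: "real set" and h f g :: "real \<Rightarrow> real" and m b c :: real
  assumes "is_interval J" and "{0<..<1} \<subseteq> J"
    and "\<forall>t\<in>J. 0 \<le> h t"
    and "m \<in> {0..1}" and "b > 0"
    and "hm_convex h m b f" and "hm_convex h m b g"
    and "c > 0"
  shows "hm_convex h m b (\<lambda>x. f x + g x) \<and> hm_convex h m b (\<lambda>x. c * f x)"
  using assms by (simp add: hm_convex_add hm_convex_cmult)

end
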